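(* Let $A$ be a finite set of words over a finite alphabet. If $\mathcal{L}_A$ is a transitive language, then there is a positive integer $r$ such that $per(\mathcal{L}_A)$ is a cofinite subset of $r\mathbb{Z}^+$.
   Context: Words are finite sequences over the alphabet; $|a|$ is the length, $ab$ concatenation, $a^n$ the $n$-fold concatenation. A factor of $b$ is a word $a$ with $b=cad$ for some (possibly empty) words $c,d$. $\mathcal{L}_A$ is the set of words with no factor in $A$. A language $\mathcal{L}$ is transitive if for all $a,b\in\mathcal{L}$ there is a (possibly empty) word $d$ with $adb\in\mathcal{L}$. A word $a\in\mathcal{L}$ is $k$-periodic in $\mathcal{L}$ if $|a|=k$ and $a^n\in\mathcal{L}$ for all $n\ge1$; $per(\mathcal{L})$ is the set of positive integers $k$ for which some word is $k$-periodic in $\mathcal{L}$. A set $S\subseteq r\mathbb{Z}^+$ is cofinite in $r\mathbb{Z}^+$ if $r\mathbb{Z}^+\setminus S$ is finite.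
   Formalization: The formal theorem additionally assumes that L_A contains a nonempty word; otherwise (e.g. A = all one-letter words) L_A is trivially transitive but per(L_A) is empty, so it is not cofinite in rZ⁺ for any r. *)

theory Defs
  imports Main "HOL-Library.Sublist"
begin

text \<open>Words are lists over a finite type; "a is a factor of b" is \<^term>\<open>sublist a b\<close>
  from HOL-Library (contiguous sublist).\<close>

definition avoid_lang :: "'a list set \<Rightarrow> 'a list set" where
  "avoid_lang A = {w. \<forall>a\<in>A. \<not> sublist a w}"

definition transitive_lang :: "'a list set \<Rightarrow> bool" where
  "transitive_lang L \<longleftrightarrow> (\<forall>a\<in>L. \<forall>b\<in>L. \<exists>d. a @ d @ b \<in> L)"

definition word_pow :: "'a list \<Rightarrow> nat \<Rightarrow> 'a list" where
  "word_pow a n = concat (replicate n a)"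

definition periodic_in :: "'a list set \<Rightarrow> nat \<Rightarrow> 'a list \<Rightarrow> bool" where
  "periodic_in L k a \<longleftrightarrow> a \<in> L \<and> length a = k \<and> (\<forall>n\<ge>1. word_pow a n \<in> L)"

definition per :: "'a list set \<Rightarrow> nat set" where
  "per L = {k. k > 0 \<and> (\<exists>a. periodic_in L k a)}"

definition pos_multiples :: "nat \<Rightarrow> nat set" where
  "pos_multiples r = {r * k | k. k > 0}"

definition cofinite_in :: "nat set \<Rightarrow> nat set \<Rightarrow> bool" where
  "cofinite_in S T \<longleftrightarrow> S \<subseteq> T \<and> finite (T - S)"

end

theory Submission
  imports Defs
begin

text \<open>Because the forbidden words have bounded length, two words of the language overlapping in
  a sufficiently long word can be glued along the overlap. Fix a long word \<open>w\<close> of the language.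
  The lengths of the words \<open>w d\<close> such that \<open>w d w\<close> is in the language form an additive semigroup
  of periods, so they contain all large multiples of their greatest common divisor \<open>r\<close>.
  Conversely, if \<open>a\<close> is periodic and \<open>n\<close> is large, then transitivity and gluing give words
  \<open>w d a\<^sup>n e w\<close> and \<open>w d a\<^sup>n a e w\<close> of the language; comparing lengths,
  \<open>r\<close> divides the length of \<open>a\<close>.\<close>

lemma nat_add_submonoid_eventually_multiples:
  fixes T :: "nat set"
  assumes zero: "0 \<in> T" and add: "\<And>x y. x \<in> T \<Longrightarrow> y \<in> T \<Longrightarrow> x + y \<in> T"
    and pos: "\<exists>x\<in>T. x > 0"
  shows "\<exists>r>0. (\<forall>x\<in>T. r dvd x) \<and> (\<exists>N. \<forall>n\<ge>N. r dvd n \<longrightarrow> n \<in> T)"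
proof -
  have mult: "k * x \<in> T" if "x \<in> T" for k x
    by (induction k) (use that zero add in auto)
  \<comment> \<open>The gcd is realised as the least positive difference of two elements.\<close>
  define P where "P r \<longleftrightarrow> r > 0 \<and> (\<exists>m\<in>T. m + r \<in> T)" for r
  define r where "r = (LEAST r. P r)"
  have "\<exists>r. P r"
    using pos zero unfolding P_def by force
  then have "P r"
    unfolding r_def by (rule LeastI_ex)
  then obtain m where r: "r > 0" and m: "m \<in> T" and mr: "m + r \<in> T"
    unfolding P_def by blast
  have least: "s \<ge> r" if "P s" for s
    unfolding r_def using that by (rule Least_le)
  \<comment> \<open>With \<open>q = x div r\<close>, the elements \<open>q * (m + r)\<close> and
    \<open>q * m + x\<close> of \<open>T\<close> differ by \<open>x mod r\<close>. A nonzero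
    remainder would be a positive difference below the least one.\<close>
  have dvd: "r dvd x" if x: "x \<in> T" for x
  proof (rule ccontr)
    assume "\<not> r dvd x"
    then have s: "x mod r > 0"
      by (simp add: dvd_eq_mod_eq_0)
    have "(x div r) * (m + r) \<in> T" "(x div r) * m + x \<in> T"
      using mult add m mr x by auto
    moreover have "(x div r) * m + x = (x div r) * (m + r) + x mod r"
      by (simp add: add_mult_distrib2)
    ultimately have "P (x mod r)"
      unfolding P_def using s by metis
    with least r show False
      by (meson mod_less_divisor not_le)
  qed
  obtain c where c: "m = r * c"
    using dvd[OF m] by blast
  \<comment> \<open>Write \<open>n = r * t\<close>. Once \<open>t \<ge> c * c\<close>, the quotient
    of \<open>t\<close> by \<open>c\<close> exceeds the remainder \<open>b\<close>, so
    \<open>b\<close> of the summands \<open>c\<close> can be enlarged to \<open>c + 1\<close>;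
    scaled by \<open>r\<close>, this writes \<open>n\<close> as a sum of copies of \<open>m\<close>
    and \<open>m + r\<close>. If \<open>c = 0\<close>, then \<open>m + r\<close> is \<open>r\<close>
    itself.\<close>
  have "n \<in> T" if n: "n \<ge> r * (c * c)" "r dvd n" for n
  proof -
    obtain t where t: "n = r * t"
      using n by blast
    show ?thesis
    proof (cases "c = 0")
      case True
      then show ?thesis
        using mult[OF mr, of t] c t by (simp add: mult.commute)
    next
      case False
      have "t \<ge> c * c"
        using n t r by simp
      then have "t div c \<ge> c"
        using False by (simp add: less_eq_div_iff_mult_less_eq)
      moreover have "t mod c < c"
        using False by simp
      ultimately obtain i where i: "t div c = i + t mod c"
        by (metis add.commute le_Suc_ex less_imp_le order.trans)
      have "t = (i + t mod c) * c + t mod c"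
        using i by (metis div_mult_mod_eq)
      moreover have "r * ((i + b) * c + b) = i * (r * c) + b * (r * c + r)" for b
        by (simp add: algebra_simps)
      ultimately have "n = i * m + (t mod c) * (m + r)"
        unfolding t c by metis
      then show ?thesis
        using add mult m mr by simp
    qed
  qed
  then show ?thesis
    using r dvd by blast
qed

text \<open>An occurrence starting inside \<open>u\<close> is too short to reach past the end of
  \<open>v\<close>; any other occurrence lies in \<open>v @ w\<close>.\<close>

lemma sublist_append_overlap:
  assumes "sublist a (u @ v @ w)" "length a \<le> length v"
  shows "sublist a (u @ v) \<or> sublist a (v @ w)"
proof -
  obtain p s where eq: "u @ v @ w = p @ a @ s"
    using assms(1) by (auto simp: sublist_def)
  show ?thesis
  proof (cases "length u \<le> length p")
    case True
    then have "v @ w = drop (length u) p @ a @ s"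
      using arg_cong[OF eq, of "drop (length u)"] by simp
    then show ?thesis
      by (auto simp: sublist_def)
  next
    case False
    then have "u @ v = p @ a @ take (length u + length v - length p - length a) s"
      using arg_cong[OF eq, of "take (length u + length v)"] assms(2) by simp
    then show ?thesis
      by (auto simp: sublist_def)
  qed
qed

lemma avoid_lang_glue:
  assumes "\<forall>a\<in>A. length a \<le> length v"
    and "u @ v \<in> avoid_lang A" "v @ w \<in> avoid_lang A"
  shows "u @ v @ w \<in> avoid_lang A"
  using assms sublist_append_overlap unfolding avoid_lang_def by blast

lemma avoid_lang_sublist:
  "w \<in> avoid_lang A \<Longrightarrow> sublist v w \<Longrightarrow> v \<in> avoid_lang A"
  unfolding avoid_lang_def using sublist_order.order_trans by blast

lemma word_pow_Suc: "word_pow a (Suc n) = a @ word_pow a n"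
  by (simp add: word_pow_def)

lemma word_pow_Suc_right: "word_pow a (Suc n) = word_pow a n @ a"
  by (induction n) (simp_all add: word_pow_def)

lemma length_word_pow: "length (word_pow a n) = n * length a"
  by (induction n) (simp_all add: word_pow_def)

lemma transitive_lang_long_word:
  assumes "transitive_lang L" "w \<in> L" "w \<noteq> []"
  shows "\<exists>v\<in>L. length v \<ge> n"
proof (induction n)
  case 0
  then show ?case using assms(2) by blast
next
  case (Suc n)
  then obtain v where "v \<in> L" "length v \<ge> n" by blast
  moreover obtain d where "w @ d @ v \<in> L"
    using assms calculation unfolding transitive_lang_def by blast
  ultimately show ?case
    using assms(3) by (intro bexI[of _ "w @ d @ v"]; cases w) auto
qed

lemma periodic_in_avoid_langI:
  assumes long: "\<forall>a\<in>A. length a \<le> length w" and mem: "w @ d @ w \<in> avoid_lang A"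
  shows "periodic_in (avoid_lang A) (length (w @ d)) (w @ d)"
proof -
  \<comment> \<open>The trailing \<open>w\<close> strengthens the induction: it is the overlap along
    which the next \<open>d @ w\<close> is glued.\<close>
  have "word_pow (w @ d) n @ w \<in> avoid_lang A" for n
  proof (induction n)
    case 0
    then show ?case
      using avoid_lang_sublist[OF mem, of w] by (simp add: word_pow_def)
  next
    case (Suc n)
    from avoid_lang_glue[OF long Suc mem] show ?case
      by (simp add: word_pow_Suc_right)
  qed
  then have "word_pow (w @ d) n \<in> avoid_lang A" for n
    by (meson avoid_lang_sublist sublist_append_rightI)
  moreover have "w @ d \<in> avoid_lang A"
    using mem by (rule avoid_lang_sublist) (metis append.assoc sublist_append_rightI)
  ultimately show ?thesis
    by (simp add: periodic_in_def)
qed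

text \<open>The power \<open>word_pow a (Suc n)\<close> both begins and ends with
  \<open>word_pow a n\<close>: \<open>x\<close> is glued on along the first copy, \<open>y\<close>
  along the last.\<close>

lemma avoid_lang_pump:
  assumes long: "\<forall>b\<in>A. length b \<le> length (word_pow a n)"
    and x: "x @ word_pow a n \<in> avoid_lang A" and y: "word_pow a n @ y \<in> avoid_lang A"
    and pow: "word_pow a (Suc n) \<in> avoid_lang A"
  shows "x @ word_pow a (Suc n) @ y \<in> avoid_lang A"
proof -
  have "x @ word_pow a n @ a \<in> avoid_lang A"
    using avoid_lang_glue[OF long x] pow by (simp add: word_pow_Suc_right)
  then have "(x @ a) @ word_pow a n \<in> avoid_lang A"
    by (simp flip: word_pow_Suc word_pow_Suc_right)
  from avoid_lang_glue[OF long this y] show ?thesis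
    by (simp add: word_pow_Suc)
qed

theorem theorem9:
  fixes A :: "'a::finite list set"
  assumes "finite A"
    and "transitive_lang (avoid_lang A)"
    and "\<exists>w\<in>avoid_lang A. w \<noteq> []"
  shows "\<exists>r>0. cofinite_in (per (avoid_lang A)) (pos_multiples r)"
proof -
  let ?L = "avoid_lang A"
  obtain M where M: "\<forall>a\<in>A. length a \<le> M"
    using finite_imageI[OF assms(1), of length] unfolding finite_nat_set_iff_bounded_le by auto
  \<comment> \<open>\<open>Suc M\<close> instead of \<open>M\<close> makes \<open>w\<close>
    nonempty, so that every \<open>length (w @ d)\<close> is positive.\<close>
  obtain w where w: "w \<in> ?L" and lw: "length w \<ge> Suc M"
    using transitive_lang_long_word[OF assms(2)] assms(3) by blast
  have long: "\<forall>a\<in>A. length a \<le> length v" if "length v \<ge> M" for v :: "'a list"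
    using M that by (meson order.trans)
  have longw: "\<forall>a\<in>A. length a \<le> length w"
    using long lw by simp
  have trans: "\<exists>d. a @ d @ b \<in> ?L" if "a \<in> ?L" "b \<in> ?L" for a b
    using assms(2) that unfolding transitive_lang_def by blast
  \<comment> \<open>Adding \<open>0\<close> makes the semigroup of lengths a monoid; its positive
    elements are still lengths of periodic words.\<close>
  define T where "T = insert 0 {length (w @ d) | d. w @ d @ w \<in> ?L}"
  have add: "x + y \<in> T" if xy: "x \<in> T" "y \<in> T" for x y
  proof (cases "x = 0 \<or> y = 0")
    case True
    then show ?thesis using xy by auto
  next
    case False
    then obtain d e where d: "x = length (w @ d)" "w @ d @ w \<in> ?L"
      and e: "y = length (w @ e)" "w @ e @ w \<in> ?L"
      using xy unfolding T_def by blast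
    have "w @ (d @ w @ e) @ w \<in> ?L"
      using avoid_lang_glue[OF longw, of "w @ d" "e @ w"] d e by simp
    moreover have "x + y = length (w @ (d @ w @ e))"
      using d e by simp
    ultimately show ?thesis
      unfolding T_def by blast
  qed
  obtain d where "w @ d @ w \<in> ?L"
    using trans w by blast
  then have "length (w @ d) \<in> T" "length (w @ d) > 0"
    using lw unfolding T_def by auto
  then have "\<exists>x\<in>T. x > 0"
    by (rule bexI[rotated])
  moreover have "0 \<in> T"
    by (simp add: T_def)
  ultimately obtain r N where r: "r > 0" and dvd: "\<And>x. x \<in> T \<Longrightarrow> r dvd x"
    and N: "\<And>n. n \<ge> N \<Longrightarrow> r dvd n \<Longrightarrow> n \<in> T"
    using nat_add_submonoid_eventually_multiples[of T, OF _ add] by metis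
  have "k \<in> pos_multiples r" if per: "k \<in> per ?L" for k
  proof -
    obtain a where k: "k > 0" "length a = k" and pow: "\<And>n. n \<ge> 1 \<Longrightarrow> word_pow a n \<in> ?L"
      using per unfolding per_def periodic_in_def by blast
    \<comment> \<open>As \<open>a\<close> is nonempty, this exponent makes \<open>v\<close> long
      enough to serve as an overlap.\<close>
    define v where "v = word_pow a (Suc M)"
    have "Suc M * 1 \<le> Suc M * k"
      using k by (intro mult_le_mono2) simp
    then have longv: "\<forall>a\<in>A. length a \<le> length v"
      using k by (intro long) (simp add: v_def length_word_pow)
    have v: "v \<in> ?L"
      unfolding v_def by (rule pow) simp
    obtain d e where d: "w @ d @ v \<in> ?L" and e: "v @ e @ w \<in> ?L"
      using trans w v by meson
    have "w @ (d @ v @ e) @ w \<in> ?L"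
      using avoid_lang_glue[OF longv, of "w @ d" "e @ w"] d e by simp
    then have "length (w @ d @ v @ e) \<in> T"
      unfolding T_def by blast
    \<comment> \<open>The connecting words \<open>d\<close> and \<open>e\<close> are kept, so the
      two elements of \<open>T\<close> differ by exactly \<open>k\<close>.\<close>
    moreover have "w @ (d @ word_pow a (Suc (Suc M)) @ e) @ w \<in> ?L"
      using avoid_lang_pump[of A a "Suc M" "w @ d" "e @ w"] longv d e pow
      unfolding v_def by simp
    then have "length (w @ d @ word_pow a (Suc (Suc M)) @ e) \<in> T"
      unfolding T_def by blast
    moreover have "length (w @ d @ word_pow a (Suc (Suc M)) @ e) = length (w @ d @ v @ e) + k"
      using k by (simp add: v_def length_word_pow)
    ultimately have "r dvd k"
      using dvd by (metis dvd_add_right_iff)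
    then show ?thesis
      using k(1) unfolding pos_multiples_def by (force elim: dvdE)
  qed
  moreover have "finite (pos_multiples r - per ?L)"
  proof (rule finite_subset)
    show "pos_multiples r - per ?L \<subseteq> {..<N}"
    proof
      fix n assume n: "n \<in> pos_multiples r - per ?L"
      then have "n > 0" "r dvd n"
        using r unfolding pos_multiples_def by auto
      moreover have "n \<in> per ?L" if "n \<in> T" "n > 0"
        using that periodic_in_avoid_langI[OF longw] unfolding T_def per_def by blast
      ultimately show "n \<in> {..<N}"
        using n N by (meson DiffD2 lessThan_iff not_le)
    qed
  qed simp
  ultimately show ?thesis
    using r unfolding cofinite_in_def by blast
qed

end
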